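(* For every EWMCP instance $(G,\boldsymbol c)$, for every coloring $\mathscr C$ of the vertices of $G$ and for every total order $\prec$ of the independent sets of $\mathscr C$, it holds that $$\mathrm{UB}_2(G,\boldsymbol c,\mathscr C,\prec)\le 2\,\mathrm{UB}_3(G,\boldsymbol c,|\mathscr C|).$$
   Context: An instance of the Edge-Weighted Maximum Clique Problem (EWMCP) is a pair $(G,\boldsymbol c)$ where $G=(V,E)$ is a finite simple undirected graph and $\boldsymbol c=(c_e)_{e\in E}$ is a vector of nonnegative integer edge-weights. For $u\in V$, $\delta(u)\subseteq E$ is the set of edges incident to $u$. A coloring $\mathscr C$ of the vertices of $G$ is a partition of $V$ into disjoint non-empty independent sets (sets of pairwise non-adjacent vertices); $|\mathscr C|$ is the number of independent sets in it. Second upper bound. Let $\prec$ be a (strict) total order on the coloring $\mathscr C$, and let $I(u)\in\mathscr C$ denote the unique member of $\mathscr C$ containing $u\in V$. For $u\in V$ set $$\sigma_u:=\sum_{I\in\mathscr C:\,I\prec I(u)}\max\{c_e: e=\{u,v\}\in\delta(u),\ v\in I\},$$ where the maximum is $0$ if no such edge exists. Then $$\mathrm{UB}_2(G,\boldsymbol c,\mathscr C,\prec):=\sum_{I\in\mathscr C}\max\{\sigma_u:u\in I\}.$$ Third upper bound. Let $k$ be an integer with $1\le k\le|V|$ that is an upper bound on the cardinality of every clique of $G$ (for instance $k=|\mathscr C|$ for a coloring $\mathscr C$). For $u\in V$ and an integer $t\ge0$, $\delta_t(u)\subseteq\delta(u)$ denotes any set of the $\min\{t,|\delta(u)|\}$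 heaviest edges incident to $u$. Set $\eta_u:=\frac12\sum_{e\in\delta_{k-1}(u)}c_e$ for $u\in V$, and order the vertices as $\varphi(1),\dots,\varphi(|V|)$ with $\eta_{\varphi(1)}\ge\eta_{\varphi(2)}\ge\dots\ge\eta_{\varphi(|V|)}$ (ties broken arbitrarily). Then $$\mathrm{UB}_3(G,\boldsymbol c,k):=\sum_{j=1}^{k}\eta_{\varphi(j)}.$$ *)

theory Defs
  imports Complex_Main "HOL-Library.Disjoint_Sets"
begin

definition simple_graph :: "'a set \<Rightarrow> 'a set set \<Rightarrow> bool" where
  "simple_graph V E \<longleftrightarrow> finite V \<and> (\<forall>e\<in>E. e \<subseteq> V \<and> card e = 2)"

definition incident_edges :: "'a set set \<Rightarrow> 'a \<Rightarrow> 'a set set" where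
  "incident_edges E u = {e \<in> E. u \<in> e}"

definition independent_set :: "'a set \<Rightarrow> 'a set set \<Rightarrow> 'a set \<Rightarrow> bool" where
  "independent_set V E I \<longleftrightarrow> I \<subseteq> V \<and> (\<forall>u\<in>I. \<forall>v\<in>I. {u, v} \<notin> E)"

definition coloring :: "'a set \<Rightarrow> 'a set set \<Rightarrow> 'a set set \<Rightarrow> bool" where
  "coloring V E C \<longleftrightarrow> partition_on V C \<and> (\<forall>I\<in>C. independent_set V E I)"

definition color_class :: "'a set set \<Rightarrow> 'a \<Rightarrow> 'a set" where
  "color_class C u = (THE I. I \<in> C \<and> u \<in> I)"

definition max_weight_to :: "'a set set \<Rightarrow> ('a set \<Rightarrow> nat) \<Rightarrow> 'a \<Rightarrow> 'a set \<Rightarrow> nat" where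
  "max_weight_to E c u I =
     (let W = {c e | e v. e = {u, v} \<and> e \<in> incident_edges E u \<and> v \<in> I}
      in if W = {} then 0 else Max W)"

(* A strict order on the color classes is a relation r; (I, J) \<in> r means that I precedes J. *)
definition sigma ::
    "'a set set \<Rightarrow> ('a set \<Rightarrow> nat) \<Rightarrow> 'a set set \<Rightarrow> 'a set rel \<Rightarrow> 'a \<Rightarrow> nat" where
  "sigma E c C r u = (\<Sum>I\<in>{I \<in> C. (I, color_class C u) \<in> r}. max_weight_to E c u I)"

definition UB2 ::
    "'a set set \<Rightarrow> ('a set \<Rightarrow> nat) \<Rightarrow> 'a set set \<Rightarrow> 'a set rel \<Rightarrow> nat" where
  "UB2 E c C r = (\<Sum>I\<in>C. Max (sigma E c C r ` I))"

definition heaviest_edges ::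
    "'a set set \<Rightarrow> ('a set \<Rightarrow> nat) \<Rightarrow> nat \<Rightarrow> 'a \<Rightarrow> 'a set set \<Rightarrow> bool" where
  "heaviest_edges E c t u F \<longleftrightarrow>
     F \<subseteq> incident_edges E u \<and> card F = min t (card (incident_edges E u)) \<and>
     (\<forall>e\<in>F. \<forall>f\<in>incident_edges E u - F. c f \<le> c e)"

(* The arbitrary choices behind the third bound are explicit parameters:
   \<delta> t u is the chosen set of t heaviest edges at u, and \<phi> is the chosen vertex order. *)
definition eta :: "('a set \<Rightarrow> nat) \<Rightarrow> (nat \<Rightarrow> 'a \<Rightarrow> 'a set set) \<Rightarrow> nat \<Rightarrow> 'a \<Rightarrow> real" where
  "eta c \<delta> k u = 1 / 2 * (\<Sum>e\<in>\<delta> (k - 1) u. real (c e))"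

definition nonincreasing_order :: "'a set \<Rightarrow> ('a \<Rightarrow> real) \<Rightarrow> (nat \<Rightarrow> 'a) \<Rightarrow> bool" where
  "nonincreasing_order V f \<phi> \<longleftrightarrow>
     bij_betw \<phi> {1..card V} V \<and>
     (\<forall>i\<in>{1..card V}. \<forall>j\<in>{1..card V}. i \<le> j \<longrightarrow> f (\<phi> j) \<le> f (\<phi> i))"

definition UB3 ::
    "('a set \<Rightarrow> nat) \<Rightarrow> (nat \<Rightarrow> 'a \<Rightarrow> 'a set set) \<Rightarrow> (nat \<Rightarrow> 'a) \<Rightarrow> nat \<Rightarrow> real" where
  "UB3 c \<delta> \<phi> k = (\<Sum>j=1..k. eta c \<delta> k (\<phi> j))"

(* Admissible choices always exist. *)
lemma ex_heaviest_edges: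
  assumes "simple_graph V E"
  shows "\<exists>F. heaviest_edges E c t u F"
proof -
  define A where "A = incident_edges E u"
  have "E \<subseteq> Pow V" "finite V"
    using assms unfolding simple_graph_def by auto
  then have "finite A"
    unfolding A_def incident_edges_def by (auto intro: finite_subset)
  then obtain xs where xs: "set xs = A" "distinct xs"
    using finite_distinct_list by blast
  define ys where "ys = sort_key (\<lambda>e. - int (c e)) xs"
  have ys: "set ys = A" "distinct ys" "sorted (map (\<lambda>e. - int (c e)) ys)"
    using xs unfolding ys_def by auto
  have "card (set (take t ys)) = min t (card A)"
    using ys by (metis distinct_card distinct_take length_take min.commute)
  moreover have "c f \<le> c e" if "e \<in> set (take t ys)" "f \<in> A - set (take t ys)" for e f
  proof -
    have "f \<in> set (drop t ys)"
      using that ys(1) by (metis Diff_iff Un_iff append_take_drop_id set_append)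
    moreover have "sorted (map (\<lambda>e. - int (c e)) (take t ys @ drop t ys))"
      using ys(3) by simp
    ultimately show ?thesis
      using that(1) unfolding map_append sorted_append by fastforce
  qed
  moreover have "set (take t ys) \<subseteq> A"
    using ys(1) set_take_subset by fast
  ultimately show ?thesis
    unfolding heaviest_edges_def A_def by blast
qed

lemma ex_nonincreasing_order:
  assumes "finite V"
  shows "\<exists>\<phi>. nonincreasing_order V f \<phi>"
proof -
  obtain xs where xs: "set xs = V" "distinct xs"
    using finite_distinct_list assms by blast
  define ys where "ys = sort_key (\<lambda>v. - f v) xs"
  have ys: "set ys = V" "distinct ys" "sorted (map (\<lambda>v. - f v) ys)"
    using xs unfolding ys_def by auto
  have len: "length ys = card V"
    using ys distinct_card by metis
  have "bij_betw (\<lambda>j::nat. j - 1) {1..card V} {..<card V}"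
    by (rule bij_betw_byWitness[where f' = Suc]) auto
  moreover have "bij_betw ((!) ys) {..<card V} V"
    using ys len by (simp add: bij_betw_nth)
  ultimately have "bij_betw (\<lambda>j. ys ! (j - 1)) {1..card V} V"
    using bij_betw_trans by (fastforce simp: comp_def)
  moreover have "f (ys ! (j - 1)) \<le> f (ys ! (i - 1))"
    if "i \<in> {1..card V}" "j \<in> {1..card V}" "i \<le> j" for i j
  proof -
    have "i - 1 \<le> j - 1" "j - 1 < length ys" using that len by auto
    then show ?thesis
      using sorted_nth_mono[OF ys(3), of "i - 1" "j - 1"] by simp
  qed
  ultimately show ?thesis
    unfolding nonincreasing_order_def by blast
qed

end

theory Submission
  imports Defs
begin

text \<open>Let \<^term>\<open>k = card C\<close>. For a vertex \<^term>\<open>u\<close>, each of the at most \<^term>\<open>k - 1\<close> classes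
  preceding that of \<^term>\<open>u\<close> contributes to \<^term>\<open>sigma E c C r u\<close> the weight of one edge from
  \<^term>\<open>u\<close> into that class (or \<open>0\<close>). The classes are disjoint, so these edges are distinct, and
  their total weight is at most that of the \<^term>\<open>k - 1\<close> heaviest edges at \<^term>\<open>u\<close>, which is
  twice \<^term>\<open>eta c \<delta> k u\<close> (lemma \<open>sigma_le_2_eta\<close>).

  Now choose in each class a vertex where the maximum in \<^term>\<open>UB2 E c C r\<close> is attained. These are
  \<^term>\<open>k\<close> distinct vertices, so the sum of their values of \<^term>\<open>eta c \<delta> k\<close> is at most
  the sum of the \<^term>\<open>k\<close> largest values, which is \<^term>\<open>UB3 c \<delta> \<phi> k\<close>
  (lemma \<open>sum_le_sum_nonincreasing_order\<close>).

  Both steps compare an arbitrary selection with a greedy one of at least the same size, which is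
  the exchange argument \<open>sum_le_sum_of_largest\<close>.\<close>

text \<open>The elements of \<^term>\<open>S - F\<close> can be exchanged injectively for elements of \<^term>\<open>F - S\<close>,
  and no such exchange decreases the value; nonnegativity covers the elements of \<^term>\<open>F - S\<close> left over.\<close>

lemma sum_le_sum_of_largest:
  fixes g :: "'a \<Rightarrow> 'b::ordered_comm_monoid_add"
  assumes "finite A" "F \<subseteq> A" "S \<subseteq> A" "card S \<le> card F"
    and dominates: "\<And>x y. x \<in> F \<Longrightarrow> y \<in> A - F \<Longrightarrow> g y \<le> g x"
    and nonneg: "\<And>x. x \<in> F \<Longrightarrow> 0 \<le> g x"
  shows "sum g S \<le> sum g F"
proof -
  have fin: "finite F" "finite S"
    using assms(1-3) finite_subset by blast+
  then have "card (S - F) \<le> card (F - S)"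
    using card_le_sym_Diff assms(4) by blast
  then obtain h where h: "h ` (S - F) \<subseteq> F - S" "inj_on h (S - F)"
    using card_le_inj[of "S - F" "F - S"] fin by auto
  have "sum g (S - F) \<le> (\<Sum>x\<in>S - F. g (h x))"
    using h(1) assms(3) by (intro sum_mono dominates) auto
  also have "\<dots> = sum g (h ` (S - F))"
    using h(2) by (simp add: sum.reindex)
  also have "\<dots> \<le> sum g (F - S)"
    using h(1) fin nonneg by (intro sum_mono2) auto
  finally have "sum g (S - F) + sum g (S \<inter> F) \<le> sum g (F - S) + sum g (F \<inter> S)"
    by (simp add: Int_commute add_right_mono)
  then show ?thesis
    using fin by (metis add.commute sum.Int_Diff)
qed

lemma finite_incident_edges:
  assumes "simple_graph V E"
  shows "finite (incident_edges E u)"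
proof -
  have "incident_edges E u \<subseteq> Pow V" "finite (Pow V)"
    using assms unfolding simple_graph_def incident_edges_def by auto
  then show ?thesis
    by (rule finite_subset)
qed

lemma color_class_eq:
  assumes "coloring V E C" "I \<in> C" "u \<in> I"
  shows "color_class C u = I"
  unfolding color_class_def
  using assms by (intro the_equality) (auto simp: coloring_def partition_on_def disjoint_def)

text \<open>The value \<open>0\<close> is excluded because it is also the convention for the case that no edge joins
  \<^term>\<open>u\<close> to \<^term>\<open>I\<close>.\<close>

lemma max_weight_to_attained:
  assumes "simple_graph V E" "max_weight_to E c u I \<noteq> 0"
  obtains v where "v \<in> I" "{u, v} \<in> incident_edges E u" "max_weight_to E c u I = c {u, v}"
proof -
  define W where "W = {c e | e v. e = {u, v} \<and> e \<in> incident_edges E u \<and> v \<in> I}"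
  have "W \<subseteq> c ` incident_edges E u"
    unfolding W_def by auto
  then have "finite W"
    using finite_incident_edges[OF assms(1)] finite_subset by blast
  moreover have "W \<noteq> {}" "max_weight_to E c u I = Max W"
    using assms(2) unfolding max_weight_to_def W_def[symmetric] by (auto simp: Let_def split: if_splits)
  ultimately have "max_weight_to E c u I \<in> W"
    using Max_in by metis
  then show ?thesis
    using that unfolding W_def by auto
qed

text \<open>Disjoint classes are reached from \<^term>\<open>u\<close> by different edges, so the sum of the maxima is
  itself the weight of a set of edges, with at most one edge for each class.\<close>

lemma sum_max_weight_to_le_heaviest:
  assumes G: "simple_graph V E" and "finite D" "disjoint D" "card D \<le> t"
    and F: "heaviest_edges E c t u F"
  shows "(\<Sum>I\<in>D. max_weight_to E c u I) \<le> sum c F"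
proof -
  \<comment> \<open>Classes of weight \<open>0\<close> may have no edge to choose from, and they do not affect the sum.\<close>
  define D' where "D' = {I \<in> D. max_weight_to E c u I \<noteq> 0}"
  have "\<forall>I\<in>D'. \<exists>v. v \<in> I \<and> {u, v} \<in> incident_edges E u \<and> max_weight_to E c u I = c {u, v}"
    unfolding D'_def using max_weight_to_attained[OF G] by (metis (mono_tags, lifting) mem_Collect_eq)
  then obtain w where w: "\<And>I. I \<in> D' \<Longrightarrow> w I \<in> I"
      "\<And>I. I \<in> D' \<Longrightarrow> {u, w I} \<in> incident_edges E u"
      "\<And>I. I \<in> D' \<Longrightarrow> max_weight_to E c u I = c {u, w I}"
    by metis
  define S where "S = (\<lambda>I. {u, w I}) ` D'"
  have inj: "inj_on (\<lambda>I. {u, w I}) D'"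
  proof (rule inj_onI)
    fix I J assume IJ: "I \<in> D'" "J \<in> D'" "{u, w I} = {u, w J}"
    then have "w I = w J"
      by (auto simp: doubleton_eq_iff)
    then have "I \<inter> J \<noteq> {}"
      using w(1)[OF IJ(1)] w(1)[OF IJ(2)] by auto
    then show "I = J"
      using IJ(1,2) \<open>disjoint D\<close> unfolding D'_def disjoint_def by auto
  qed
  have "(\<Sum>I\<in>D. max_weight_to E c u I) = (\<Sum>I\<in>D'. max_weight_to E c u I)"
    using \<open>finite D\<close> unfolding D'_def by (intro sum.mono_neutral_right) auto
  also have "\<dots> = sum c S"
    unfolding S_def using inj w(3) by (simp add: sum.reindex)
  also have "\<dots> \<le> sum c F"
  proof (rule sum_le_sum_of_largest)
    show fin: "finite (incident_edges E u)"
      using G by (rule finite_incident_edges)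
    show S: "S \<subseteq> incident_edges E u"
      unfolding S_def using w(2) by auto
    have "card S = card D'"
      unfolding S_def using inj by (rule card_image)
    also have "\<dots> \<le> card D"
      unfolding D'_def using \<open>finite D\<close> by (intro card_mono) auto
    finally have "card S \<le> card D" .
    then show "card S \<le> card F"
      using F \<open>card D \<le> t\<close> card_mono[OF fin S] unfolding heaviest_edges_def by auto
  qed (use F in \<open>auto simp: heaviest_edges_def\<close>)
  finally show ?thesis .
qed

text \<open>The class of \<^term>\<open>u\<close> does not precede itself, which leaves at most \<^term>\<open>card C - 1\<close>
  classes; this is where the index \<^term>\<open>k - 1\<close> in \<^term>\<open>eta c \<delta> k u\<close> comes from.\<close>

lemma sigma_le_2_eta:
  assumes G: "simple_graph V E" and col: "coloring V E C" and r: "irrefl r"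
    and "finite C" "I \<in> C" "u \<in> I"
    and F: "heaviest_edges E c (card C - 1) u (\<delta> (card C - 1) u)"
  shows "real (sigma E c C r u) \<le> 2 * eta c \<delta> (card C) u"
proof -
  define D where "D = {J \<in> C. (J, I) \<in> r}"
  have D: "D \<subseteq> C - {I}"
    unfolding D_def using r by (auto simp: irrefl_def)
  have "card D \<le> card C - 1"
    using card_mono[OF _ D] \<open>finite C\<close> \<open>I \<in> C\<close> by simp
  moreover have "finite D" "disjoint D"
    using D \<open>finite C\<close> col
    by (auto simp: coloring_def partition_on_def disjoint_def intro: finite_subset)
  ultimately have "(\<Sum>J\<in>D. max_weight_to E c u J) \<le> sum c (\<delta> (card C - 1) u)"
    using sum_max_weight_to_le_heaviest[OF G _ _ _ F] by blast
  moreover have "sigma E c C r u = (\<Sum>J\<in>D. max_weight_to E c u J)"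
    using color_class_eq[OF col \<open>I \<in> C\<close> \<open>u \<in> I\<close>] unfolding sigma_def D_def by simp
  ultimately have "real (sigma E c C r u) \<le> real (sum c (\<delta> (card C - 1) u))"
    by (simp only: of_nat_le_iff)
  also have "\<dots> = 2 * eta c \<delta> (card C) u"
    unfolding eta_def by simp
  finally show ?thesis .
qed

lemma sum_le_sum_nonincreasing_order:
  assumes \<phi>: "nonincreasing_order V f \<phi>" and "finite V" "S \<subseteq> V"
    and nonneg: "\<And>v. v \<in> V \<Longrightarrow> 0 \<le> f v"
  shows "sum f S \<le> (\<Sum>j=1..card S. f (\<phi> j))"
proof -
  define F where "F = \<phi> ` {1..card S}"
  have bij: "bij_betw \<phi> {1..card V} V"
    and mono: "\<And>i j. i \<in> {1..card V} \<Longrightarrow> j \<in> {1..card V} \<Longrightarrow> i \<le> j \<Longrightarrow> f (\<phi> j) \<le> f (\<phi> i)"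
    using \<phi> unfolding nonincreasing_order_def by auto
  have sub: "{1..card S} \<subseteq> {1..card V}"
    using card_mono[OF \<open>finite V\<close> \<open>S \<subseteq> V\<close>] by auto
  have inj: "inj_on \<phi> {1..card S}"
    using bij sub by (meson bij_betw_def inj_on_subset)
  have F: "F \<subseteq> V"
    unfolding F_def using bij sub by (auto simp: bij_betw_def)
  have "sum f S \<le> sum f F"
  proof (rule sum_le_sum_of_largest[OF \<open>finite V\<close> F \<open>S \<subseteq> V\<close>])
    show "card S \<le> card F"
      unfolding F_def using inj by (simp add: card_image)
  next
    fix x y assume "x \<in> F" "y \<in> V - F"
    then obtain i j where "x = \<phi> i" "i \<in> {1..card S}" "y = \<phi> j" "j \<in> {1..card V}" "j \<notin> {1..card S}"
      using bij unfolding F_def bij_betw_def by blast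
    then show "f y \<le> f x"
      using sub by (auto intro!: mono)
  qed (use F nonneg in auto)
  also have "\<dots> = (\<Sum>j=1..card S. f (\<phi> j))"
    unfolding F_def using inj by (simp add: sum.reindex)
  finally show ?thesis .
qed

theorem proposition5:
  fixes V :: "'a set" and E :: "'a set set" and c :: "'a set \<Rightarrow> nat"
    and C :: "'a set set" and r :: "'a set rel"
    and \<delta> :: "nat \<Rightarrow> 'a \<Rightarrow> 'a set set" and \<phi> :: "nat \<Rightarrow> 'a"
  assumes "simple_graph V E"
    and "coloring V E C"
    and "strict_linear_order_on C r"
    and "\<And>t u. u \<in> V \<Longrightarrow> heaviest_edges E c t u (\<delta> t u)"
    and "nonincreasing_order V (eta c \<delta> (card C)) \<phi>"
  shows "real (UB2 E c C r) \<le> 2 * UB3 c \<delta> \<phi> (card C)"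
proof -
  let ?\<eta> = "eta c \<delta> (card C)"
  have finV: "finite V" and part: "partition_on V C"
    using assms(1,2) by (auto simp: simple_graph_def coloring_def)
  have finC: "finite C"
    using finV part by (rule finite_elements)
  have sub: "\<And>I. I \<in> C \<Longrightarrow> I \<subseteq> V" and ne: "\<And>I. I \<in> C \<Longrightarrow> I \<noteq> {}" and dis: "disjoint C"
    using part by (auto simp: partition_on_def)
  have irr: "irrefl r"
    using assms(3) by (simp add: strict_linear_order_on_def)
  have "\<forall>I\<in>C. \<exists>u\<in>I. Max (sigma E c C r ` I) = sigma E c C r u"
  proof
    fix I assume "I \<in> C"
    then have "Max (sigma E c C r ` I) \<in> sigma E c C r ` I"
      using sub ne finV by (intro Max_in) (auto intro: finite_subset)
    then show "\<exists>u\<in>I. Max (sigma E c C r ` I) = sigma E c C r u"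
      by auto
  qed
  then obtain w where w: "\<And>I. I \<in> C \<Longrightarrow> w I \<in> I"
      "\<And>I. I \<in> C \<Longrightarrow> Max (sigma E c C r ` I) = sigma E c C r (w I)"
    by metis
  have inj: "inj_on w C"
    using w(1) dis unfolding inj_on_def disjoint_def by (metis disjoint_iff)
  have wV: "w ` C \<subseteq> V"
    using w(1) sub by auto
  have "real (UB2 E c C r) = (\<Sum>I\<in>C. real (sigma E c C r (w I)))"
    unfolding UB2_def using w(2) by simp
  also have "\<dots> \<le> (\<Sum>I\<in>C. 2 * ?\<eta> (w I))"
  proof (rule sum_mono)
    fix I assume I: "I \<in> C"
    then have "w I \<in> V"
      using w(1) sub by blast
    then show "real (sigma E c C r (w I)) \<le> 2 * ?\<eta> (w I)"
      using sigma_le_2_eta[where \<delta> = \<delta>, OF assms(1,2) irr finC I w(1)[OF I] assms(4)] by blast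
  qed
  also have "\<dots> = 2 * sum ?\<eta> (w ` C)"
    using inj by (simp add: sum.reindex sum_distrib_left)
  also have "\<dots> \<le> 2 * (\<Sum>j=1..card (w ` C). ?\<eta> (\<phi> j))"
    using sum_le_sum_nonincreasing_order[OF assms(5) finV wV]
    by (simp add: eta_def sum_nonneg)
  also have "\<dots> = 2 * UB3 c \<delta> \<phi> (card C)"
    using inj by (simp add: UB3_def card_image)
  finally show ?thesis .
qed

end
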